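(* Let $n\ge1$, $c\ge0$, and $P \in \widetilde{L}^{+}_{n,n,c+1}$. If $\operatorname{area}(P)=a$ and $\operatorname{dinv}(P)=b$, then $$a + b + \binom{c+1}{2} \leq \binom{n}{2}.$$
   Context: A Schröder path of size $n$ is a lattice path from $(0,0)$ to $(n,n)$ using North steps $(0,1)$, East steps $(1,0)$ and diagonal steps $(1,1)$, staying weakly above $y=x$. $\widetilde{L}^{+}_{n,n,d}$ is the set of such paths with $n-d$ North steps, $n-d$ East steps and $d$ diagonal steps, such that no diagonal step occurs after (above) the highest North step. $\operatorname{area}(P)$ is the number of full unit cells between $y=x$ and the Dyck path obtained from $P$ by replacing each diagonal step by a North step followed by an East step. A North step from $(i,j)$ to $(i,j+1)$ lies in the $(j-i)$-diagonal and in column $i$. Two North steps are attacking if they lie in the same diagonal, or they lie in consecutive diagonals and the one in a strictly further-left column lies in the higher diagonal. $\operatorname{dinv}(P)$ is the number of attacking pairs of North steps of $P$. *)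

theory Defs
  imports Complex_Main
begin

datatype step = North | East | Diagonal

fun advance :: "step \<Rightarrow> nat \<times> nat \<Rightarrow> nat \<times> nat" where
  "advance North (x, y) = (x, Suc y)"
| "advance East (x, y) = (Suc x, y)"
| "advance Diagonal (x, y) = (Suc x, Suc y)"

definition position :: "step list \<Rightarrow> nat \<Rightarrow> nat \<times> nat" where
  "position P k = fold advance (take k P) (0, 0)"

definition schroeder_path :: "nat \<Rightarrow> step list \<Rightarrow> bool" where
  "schroeder_path n P \<longleftrightarrow>
     position P (length P) = (n, n) \<and>
     (\<forall>k \<le> length P. fst (position P k) \<le> snd (position P k))"

text \<open>
  The highest North step of a path is its last one, i.e. the one with no North step in
  the remaining path \<open>ys\<close>. The sum \<open>count_list P North + d = n\<close> avoids truncated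
  subtraction, so that the set is empty for \<open>d > n\<close>. For \<open>d = n\<close> there is no North step,
  the last condition is vacuous and the set consists of the all-diagonal path.
\<close>
definition L_tilde_plus :: "nat \<Rightarrow> nat \<Rightarrow> step list set" where
  "L_tilde_plus n d =
     {P. schroeder_path n P \<and>
         count_list P North + d = n \<and>
         count_list P East + d = n \<and>
         count_list P Diagonal = d \<and>
         (\<forall>xs ys. P = xs @ North # ys \<and> North \<notin> set ys \<longrightarrow> Diagonal \<notin> set ys)}"

text \<open>A North step is represented by its starting point.\<close>
definition north_steps :: "step list \<Rightarrow> (nat \<times> nat) set" where
  "north_steps P = {position P k |k. k < length P \<and> P ! k = North}"

definition dyck_of :: "step list \<Rightarrow> step list" where
  "dyck_of P = concat (map (\<lambda>s. if s = Diagonal then [North, East] else [s]) P)"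

text \<open>
  The pair \<open>(i, j)\<close> stands for the unit cell with lower left corner \<open>(i, j)\<close>. It lies
  entirely above \<open>y = x\<close> iff \<open>i < j\<close>, and below the Dyck path iff the North step
  of that path in row \<open>j\<close> is weakly to the left of the cell.
\<close>
definition area :: "step list \<Rightarrow> nat" where
  "area P = card {(i, j). i < j \<and> (\<exists>x \<le> i. (x, j) \<in> north_steps (dyck_of P))}"

definition diagonal_of :: "nat \<times> nat \<Rightarrow> int" where
  "diagonal_of p = int (snd p) - int (fst p)"

definition column_of :: "nat \<times> nat \<Rightarrow> nat" where
  "column_of p = fst p"

definition attacking :: "nat \<times> nat \<Rightarrow> nat \<times> nat \<Rightarrow> bool" where
  "attacking p q \<longleftrightarrow>
     diagonal_of p = diagonal_of q \<or>
     (diagonal_of p = diagonal_of q + 1 \<and> column_of p < column_of q) \<or>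
     (diagonal_of q = diagonal_of p + 1 \<and> column_of q < column_of p)"

definition dinv :: "step list \<Rightarrow> nat" where
  "dinv P = card {{p, q} |p q. p \<in> north_steps P \<and> q \<in> north_steps P \<and> p \<noteq> q \<and> attacking p q}"

end

theory Submission
  imports Defs
begin

text \<open>
  Each of the \<open>n\<close> rows contains exactly one step that is North or Diagonal, so there are
  \<open>n choose 2\<close> pairs of rows. Among them, the pairs of Diagonal rows number \<open>(c + 1) choose 2\<close>,
  and the attacking pairs are pairs of North rows. A row starting on diagonal \<open>a\<close> contributes
  \<open>a\<close> cells to the area; since only a North step moves the path to a higher diagonal, each of
  the diagonals \<open>0, \<dots>, a - 1\<close> contains a North step in an earlier row. This charges the cells
  injectively to pairs of rows consisting of a North row and a later row on a strictly higher
  diagonal, and no such pair is attacking.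
\<close>

definition endpoint :: "step list \<Rightarrow> nat \<times> nat" where
  "endpoint P = fold advance P (0, 0)"

lemma endpoint_Nil [simp]: "endpoint [] = (0, 0)"
  by (simp add: endpoint_def)

lemma endpoint_snoc [simp]: "endpoint (P @ [s]) = advance s (endpoint P)"
  by (simp add: endpoint_def)

lemma position_length: "position P (length P) = endpoint P"
  by (simp add: position_def endpoint_def)

lemma fst_advance: "fst (advance s p) = (if s = North then fst p else Suc (fst p))"
  by (cases s; cases p) auto

lemma snd_advance: "snd (advance s p) = (if s = East then snd p else Suc (snd p))"
  by (cases s; cases p) auto

lemma north_steps_Nil [simp]: "north_steps [] = {}"
  by (simp add: north_steps_def)

lemma north_steps_snoc [simp]:
  "north_steps (P @ [s]) = north_steps P \<union> (if s = North then {endpoint P} else {})"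
proof -
  have image: "north_steps Q = position Q ` {k \<in> {..<length Q}. Q ! k = North}" for Q
    by (auto simp: north_steps_def)
  have indices: "{k \<in> {..<length (P @ [s])}. (P @ [s]) ! k = North} =
      {k \<in> {..<length P}. P ! k = North} \<union> (if s = North then {length P} else {})"
    by (auto simp: nth_append)
  have position: "position (P @ [s]) k = position P k" if "k \<le> length P" for k s
    using that by (simp add: position_def)
  have "position (P @ [s]) ` {k \<in> {..<length P}. P ! k = North} = north_steps P"
    unfolding image by (rule image_cong) (simp_all add: position)
  then show ?thesis
    unfolding image[of "P @ [s]"] indices image_Un by (simp add: position position_length)
qed

text \<open>The starts of the North and Diagonal steps of \<open>P\<close>: a Diagonal step is
  replaced by a North step from the same point. They represent the rows.\<close>

definition row_steps :: "step list \<Rightarrow> (nat \<times> nat) set" where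
  "row_steps P = north_steps (dyck_of P)"

lemma endpoint_dyck_of: "endpoint (dyck_of P) = endpoint P"
proof (induction P rule: rev_induct)
  case Nil
  then show ?case by (simp add: dyck_of_def)
next
  case (snoc s P)
  then show ?case
    by (cases s; cases "fold advance P (0, 0)") (auto simp: dyck_of_def endpoint_def)
qed

lemma row_steps_Nil [simp]: "row_steps [] = {}"
  by (simp add: row_steps_def dyck_of_def)

lemma row_steps_snoc [simp]:
  "row_steps (P @ [s]) = row_steps P \<union> (if s = East then {} else {endpoint P})"
proof (cases s)
  case Diagonal
  have "dyck_of (P @ [s]) = (dyck_of P @ [North]) @ [East]"
    by (simp add: dyck_of_def Diagonal)
  then show ?thesis
    by (simp only: row_steps_def north_steps_snoc) (simp add: Diagonal endpoint_dyck_of)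
next
  case North
  have "dyck_of (P @ [s]) = dyck_of P @ [North]"
    by (simp add: dyck_of_def North)
  then show ?thesis
    by (simp add: row_steps_def North endpoint_dyck_of)
next
  case East
  have "dyck_of (P @ [s]) = dyck_of P @ [East]"
    by (simp add: dyck_of_def East)
  then show ?thesis
    by (simp add: row_steps_def East)
qed

lemma north_steps_subset_row_steps: "north_steps P \<subseteq> row_steps P"
  by (induction P rule: rev_induct) auto

text \<open>Each North or Diagonal step starts one unit above the previous such step, the first one
  at height 0, since East steps keep the height.\<close>

lemma bij_betw_snd_row_steps: "bij_betw snd (row_steps P) {..<snd (endpoint P)}"
proof (induction P rule: rev_induct)
  case Nil
  then show ?case by (simp add: bij_betw_def)
next
  case (snoc s P)
  show ?case
  proof (cases "s = East")
    case True
    then show ?thesis using snoc by (simp add: snd_advance)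
  next
    case False
    have "endpoint P \<notin> row_steps P"
      using snoc by (auto simp: bij_betw_def)
    then show ?thesis
      using False snoc by (auto simp: bij_betw_def snd_advance lessThan_Suc)
  qed
qed

lemma finite_row_steps: "finite (row_steps P)"
  using bij_betw_finite[OF bij_betw_snd_row_steps] by simp

lemma finite_north_steps: "finite (north_steps P)"
  by (rule finite_subset[OF north_steps_subset_row_steps finite_row_steps])

lemma card_row_steps: "card (row_steps P) = snd (endpoint P)"
  using bij_betw_same_card[OF bij_betw_snd_row_steps] by simp

lemma snd_row_steps_less: "p \<in> row_steps P \<Longrightarrow> snd p < snd (endpoint P)"
  using bij_betw_apply[OF bij_betw_snd_row_steps, of p P] by simp

lemma card_north_steps: "card (north_steps P) = count_list P North"
proof (induction P rule: rev_induct)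
  case Nil
  then show ?case by simp
next
  case (snoc s P)
  have "endpoint P \<notin> north_steps P"
    using north_steps_subset_row_steps[of P] snd_row_steps_less[of "endpoint P" P] by blast
  then show ?case
    using snoc finite_north_steps by simp
qed

text \<open>Discrete intermediate value argument: the path starts on diagonal 0 and climbs one
  diagonal at a time, so some North step leaves diagonal \<open>l\<close>.\<close>

lemma north_step_on_lower_diagonal:
  assumes "int l < diagonal_of (endpoint P)"
  shows "\<exists>p \<in> north_steps P. diagonal_of p = int l"
  using assms
proof (induction P rule: rev_induct)
  case Nil
  then show ?case by (simp add: diagonal_of_def)
next
  case (snoc s P)
  \<comment> \<open>East lowers the diagonal and Diagonal keeps it, so either the shorter path
    already ends above \<open>l\<close>, or the last step is the North step sought.\<close>
  have "int l < diagonal_of (endpoint P) \<or> s = North \<and> int l = diagonal_of (endpoint P)"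
    using snoc.prems by (cases s) (auto simp: diagonal_of_def fst_advance snd_advance)
  then show ?case
    using snoc.IH by auto
qed

text \<open>The previous argument applies to the part of the path that ends at \<open>q\<close>,
  whose North steps all start below \<open>q\<close>.\<close>

lemma earlier_north_step_on_lower_diagonal:
  assumes "q \<in> row_steps P" and "int l < diagonal_of q"
  shows "\<exists>p \<in> north_steps P. diagonal_of p = int l \<and> snd p < snd q"
  using assms
proof (induction P rule: rev_induct)
  case Nil
  then show ?case by simp
next
  case (snoc s P)
  show ?case
  proof (cases "q \<in> row_steps P")
    case True
    then show ?thesis using snoc by auto
  next
    case False
    then have "q = endpoint P"
      using snoc.prems by (auto split: if_splits)
    then obtain p where "p \<in> north_steps P" "diagonal_of p = int l"
      using north_step_on_lower_diagonal snoc.prems by blast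
    moreover from this have "snd p < snd q"
      using north_steps_subset_row_steps[of P] snd_row_steps_less[of p P] \<open>q = endpoint P\<close> by blast
    ultimately show ?thesis by auto
  qed
qed

text \<open>The pairs that area cells are charged to. Here \<open>q\<close> may start a Diagonal
  step but \<open>p\<close> may not, which keeps these apart from pairs of Diagonal rows.\<close>

definition rising_pairs :: "step list \<Rightarrow> ((nat \<times> nat) \<times> (nat \<times> nat)) set" where
  "rising_pairs P = {(p, q). p \<in> north_steps P \<and> q \<in> row_steps P \<and>
     snd p < snd q \<and> diagonal_of p < diagonal_of q}"

lemma finite_rising_pairs: "finite (rising_pairs P)"
  by (rule finite_subset[of _ "north_steps P \<times> row_steps P"])
    (auto simp: rising_pairs_def finite_north_steps finite_row_steps)

text \<open>Only an inequality: several North steps below \<open>q\<close> on one diagonal yield the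
  same cell, so the map from pairs to cells need not be injective.\<close>

lemma area_le_card_rising_pairs: "area P \<le> card (rising_pairs P)"
proof -
  \<comment> \<open>The area cells in the row of \<open>q\<close> occupy columns
    \<open>fst q\<close> to \<open>snd q - 1\<close>; a \<open>p\<close> on diagonal
    \<open>l\<close> picks number \<open>l\<close> from the right, counting from 0.\<close>
  let ?cell = "\<lambda>(p, q). (nat (int (snd q) - 1 - diagonal_of p), snd q)"
  have "{(i, j). i < j \<and> (\<exists>x \<le> i. (x, j) \<in> row_steps P)} \<subseteq> ?cell ` rising_pairs P"
  proof clarify
    fix i j x
    assume "i < j" "x \<le> i" and q: "(x, j) \<in> row_steps P"
    then have "int (j - 1 - i) < diagonal_of (x, j)"
      by (simp add: diagonal_of_def)
    then obtain p where p: "p \<in> north_steps P" "diagonal_of p = int (j - 1 - i)" "snd p < j"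
      using earlier_north_step_on_lower_diagonal[OF q] unfolding snd_conv by blast
    then have "(p, (x, j)) \<in> rising_pairs P"
      using q \<open>int (j - 1 - i) < diagonal_of (x, j)\<close> by (simp add: rising_pairs_def)
    moreover have "(i, j) = ?cell (p, (x, j))"
      using p \<open>i < j\<close> by simp
    ultimately show "(i, j) \<in> ?cell ` rising_pairs P"
      by (rule rev_image_eqI)
  qed
  then show ?thesis
    unfolding area_def row_steps_def[symmetric]
    by (rule surj_card_le[OF finite_rising_pairs])
qed

text \<open>The heights differ, so the unordered pair still determines which element is
  \<open>p\<close>.\<close>

lemma card_unordered_rising_pairs:
  "card ((\<lambda>(p, q). {p, q}) ` rising_pairs P) = card (rising_pairs P)"
  by (rule card_image) (auto simp: inj_on_def rising_pairs_def doubleton_eq_iff)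

lemma attacking_sym: "attacking p q \<Longrightarrow> attacking q p"
  by (auto simp: attacking_def)

text \<open>If \<open>q\<close> were one diagonal higher and in a column further left, its height,
  column plus diagonal, would be at most that of \<open>p\<close>.\<close>

lemma not_attacking_if_rising:
  "snd p < snd q \<Longrightarrow> diagonal_of p < diagonal_of q \<Longrightarrow> \<not> attacking p q"
  by (auto simp: attacking_def diagonal_of_def column_of_def)

lemma area_dinv_diagonals_le:
  "area P + dinv P + (card (row_steps P - north_steps P) choose 2) \<le> card (row_steps P) choose 2"
proof -
  let ?U = "row_steps P" and ?N = "north_steps P"
  let ?R = "(\<lambda>(p, q). {p, q}) ` rising_pairs P"
  let ?A = "{{p, q} |p q. p \<in> ?N \<and> q \<in> ?N \<and> p \<noteq> q \<and> attacking p q}"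
  let ?D = "{B. B \<subseteq> ?U - ?N \<and> card B = 2}"
  let ?T = "{B. B \<subseteq> ?U \<and> card B = 2}"
  note NU = north_steps_subset_row_steps[of P]
  have fin: "finite ?T"
    using finite_row_steps by simp
  have R: "?R \<subseteq> ?T"
    using NU by (auto simp: rising_pairs_def card_insert_if)
  have A: "?A \<subseteq> ?T"
    using NU by (auto simp: card_insert_if)
  have D: "?D \<subseteq> ?T"
    by auto
  have RA: "?R \<inter> ?A = {}"
  proof (rule equals0I, elim IntE)
    fix B
    assume "B \<in> ?R" and "B \<in> ?A"
    from \<open>B \<in> ?R\<close> obtain p q where pq: "(p, q) \<in> rising_pairs P" "B = {p, q}"
      by auto
    from \<open>B \<in> ?A\<close> obtain p' q' where "B = {p', q'}" "attacking p' q'"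
      by auto
    then have "attacking p q"
      using pq(2) attacking_sym[of p' q'] by (auto simp: doubleton_eq_iff)
    then show False
      using pq(1) not_attacking_if_rising by (simp add: rising_pairs_def)
  qed
  \<comment> \<open>Sets in \<open>?R\<close> and \<open>?A\<close> contain the start of a North
    step, sets in \<open>?D\<close> contain none.\<close>
  have RAD: "(?R \<union> ?A) \<inter> ?D = {}"
    by (auto simp: rising_pairs_def)
  have "card ?R + card ?A + card ?D = card (?R \<union> ?A \<union> ?D)"
    using RA RAD finite_subset[OF R fin] finite_subset[OF A fin] finite_subset[OF D fin]
    by (simp add: card_Un_disjoint)
  also have "\<dots> \<le> card ?T"
    using R A D by (intro card_mono fin) auto
  finally have "card (rising_pairs P) + dinv P + (card (?U - ?N) choose 2) \<le> card ?U choose 2"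
    by (simp add: card_unordered_rising_pairs dinv_def n_subsets finite_row_steps)
  then show ?thesis
    using area_le_card_rising_pairs[of P] by linarith
qed

theorem theorem4p14:
  fixes n c a b :: nat and P :: "step list"
  assumes "n \<ge> 1"
    and "P \<in> L_tilde_plus n (c + 1)"
    and "area P = a"
    and "dinv P = b"
  shows "a + b + ((c + 1) choose 2) \<le> n choose 2"
proof -
  have "endpoint P = (n, n)" and count: "count_list P North + (c + 1) = n"
    using assms(2) by (auto simp: L_tilde_plus_def schroeder_path_def position_length)
  then have U: "card (row_steps P) = n"
    by (simp add: card_row_steps)
  \<comment> \<open>The number of Diagonal rows, obtained as \<open>n\<close> minus the number of
    North steps.\<close>
  have "card (row_steps P - north_steps P) = c + 1"
    using U count
    by (simp add: card_Diff_subset finite_north_steps north_steps_subset_row_steps card_north_steps)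
  then show ?thesis
    using area_dinv_diagonals_le[of P] U assms(3,4) by simp
qed

end
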